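(* For every $\varepsilon\in(0,\frac12)$ and every monotone function $f:\{0,1\}^n\to\{\pm1\}$ computable by a decision tree of size $s$, regardless of how ties are broken in $\textsc{BuildTopDownDT}$, we have $\textsc{TopDownDTSize}(f,\varepsilon)\le s^{O(\sqrt{\log s}/\varepsilon)}$.
   Context: $f$ is monotone if $f(x)\le f(y)$ whenever $x_i\le y_i$ for all $i$. The size of a decision tree is its number of leaves; logarithms are base 2. The influence of variable $i$ on $g$ is $\mathrm{Inf}_i(g)=\Pr_{\mathbf{x}}[g(\mathbf{x})\ne g(\mathbf{x}^{\oplus i})]$ with $\mathbf{x}$ uniform on $\{0,1\}^n$ and $\mathbf{x}^{\oplus i}$ being $\mathbf{x}$ with coordinate $i$ flipped. A bare tree is a decision tree with unlabeled leaves; for a leaf $\ell$, $f_\ell$ is the restriction of $f$ by the path to $\ell$ and $|\ell|$ its depth. The $f$-completion labels each leaf $\ell$ by $\mathrm{sign}(\mathbb{E}[f_\ell])$. $T$ is an $\varepsilon$-approximation of $f$ if $\Pr_{\mathbf{x}}[T(\mathbf{x})\ne f(\mathbf{x})]\le\varepsilon$. $\textsc{BuildTopDownDT}(f,\varepsilon)$: start with the one-leaf bare tree $T^\circ$; while the $f$-completion of $T^\circ$ is not an $\varepsilon$-approximation of $f$, for each leaf $\ell$ let $x_{i(\ell)}$ maximize $\mathrm{Inf}_i(f_\ell)$, set $\mathrm{score}(\ell)=2^{-|\ell|}\mathrm{Inf}_{i(\ell)}(f_\ell)$, and replace a highest-score leaf $\ell^\star$ by a query to $x_{i(\ell^\star)}$;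 output the $f$-completion. $\textsc{TopDownDTSize}(f,\varepsilon)$ is the size of the output. *)

theory Defs
  imports "HOL-Probability.Probability"
begin

text \<open>
  A point of the Boolean cube \<open>{0,1}\<^sup>n\<close> is an extensional function
  \<open>nat \<Rightarrow> bool\<close> on the coordinates \<open>{..<n}\<close>. Functions on the cube have real values,
  constrained to \<open>{-1, 1}\<close> where needed. All points of \<open>cube n\<close> agree outside \<open>{..<n}\<close>, so the
  pointwise order of the function space is the coordinatewise order, and monotonicity on the
  cube is the library's \<open>mono_on (cube n)\<close>.
\<close>

definition cube :: "nat \<Rightarrow> (nat \<Rightarrow> bool) set" where
  "cube n = ({..<n} \<rightarrow>\<^sub>E UNIV)"

abbreviation unif :: "nat \<Rightarrow> (nat \<Rightarrow> bool) pmf" where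
  "unif n \<equiv> pmf_of_set (cube n)"

definition influence :: "nat \<Rightarrow> nat \<Rightarrow> ((nat \<Rightarrow> bool) \<Rightarrow> real) \<Rightarrow> real" where
  "influence n i g = measure_pmf.prob (unif n) {x. g x \<noteq> g (x(i := \<not> x i))}"

text \<open>
  The left subtree of \<open>Query i l r\<close> is taken when \<open>x i = False\<close>. Bare trees are
  \<open>unit dtree\<close>s.
\<close>

datatype (leaf_labels: 'l) dtree = Leaf 'l | Query nat "'l dtree" "'l dtree"

fun eval_dt :: "'l dtree \<Rightarrow> (nat \<Rightarrow> bool) \<Rightarrow> 'l" where
  "eval_dt (Leaf b) x = b"
| "eval_dt (Query i l r) x = (if x i then eval_dt r x else eval_dt l x)"

fun queried_vars :: "'l dtree \<Rightarrow> nat set" where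
  "queried_vars (Leaf b) = {}"
| "queried_vars (Query i l r) = insert i (queried_vars l \<union> queried_vars r)"

fun dt_size :: "'l dtree \<Rightarrow> nat" where
  "dt_size (Leaf b) = 1"
| "dt_size (Query i l r) = dt_size l + dt_size r"

definition computable_by_dt_of_size :: "nat \<Rightarrow> ((nat \<Rightarrow> bool) \<Rightarrow> real) \<Rightarrow> nat \<Rightarrow> bool" where
  "computable_by_dt_of_size n f s \<longleftrightarrow>
     (\<exists>T. queried_vars T \<subseteq> {..<n} \<and> leaf_labels T \<subseteq> {-1, 1} \<and> dt_size T = s \<and>
          (\<forall>x\<in>cube n. eval_dt T x = f x))"

text \<open>
  A leaf is identified with its root-to-leaf path, the list of the queried variables together
  with their answers; its depth is the length of that list.
\<close>

type_synonym path = "(nat \<times> bool) list"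

fun leaves :: "'l dtree \<Rightarrow> path set" where
  "leaves (Leaf b) = {[]}"
| "leaves (Query i l r) = Cons (i, False) ` leaves l \<union> Cons (i, True) ` leaves r"

text \<open>
  The restriction of \<open>f\<close> by a path is kept as a function on the whole cube that ignores the
  coordinates fixed by the path. This changes neither its expectation nor the influences of the
  free variables, and it gives the fixed variables influence 0.
\<close>

fun restrict_path :: "((nat \<Rightarrow> bool) \<Rightarrow> 'a) \<Rightarrow> path \<Rightarrow> (nat \<Rightarrow> bool) \<Rightarrow> 'a" where
  "restrict_path f [] = f"
| "restrict_path f ((i, b) # p) = restrict_path (\<lambda>x. f (x(i := b))) p"

fun label_leaves :: "(path \<Rightarrow> 'b) \<Rightarrow> 'a dtree \<Rightarrow> 'b dtree" where
  "label_leaves g (Leaf b) = Leaf (g [])"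
| "label_leaves g (Query i l r) =
     Query i (label_leaves (\<lambda>p. g ((i, False) # p)) l) (label_leaves (\<lambda>p. g ((i, True) # p)) r)"

text \<open>
  Unlike \<open>sgn\<close>, this sign always lies in \<open>{-1, 1}\<close>. The value at 0 is a convention: a leaf whose
  restriction is balanced has error 1/2 under either label, so the choice affects neither the
  course of the algorithm below nor the size of its output.
\<close>

definition pm_sign :: "real \<Rightarrow> real" where
  "pm_sign t = (if t < 0 then -1 else 1)"

definition completion :: "nat \<Rightarrow> ((nat \<Rightarrow> bool) \<Rightarrow> real) \<Rightarrow> unit dtree \<Rightarrow> real dtree" where
  "completion n f T =
     label_leaves (\<lambda>p. pm_sign (measure_pmf.expectation (unif n) (restrict_path f p))) T"

definition approximates :: "nat \<Rightarrow> real \<Rightarrow> ((nat \<Rightarrow> bool) \<Rightarrow> real) \<Rightarrow> real dtree \<Rightarrow> bool" where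
  "approximates n \<epsilon> f T \<longleftrightarrow> measure_pmf.prob (unif n) {x. eval_dt T x \<noteq> f x} \<le> \<epsilon>"

fun split_leaf :: "path \<Rightarrow> nat \<Rightarrow> unit dtree \<Rightarrow> unit dtree" where
  "split_leaf [] i (Leaf u) = Query i (Leaf ()) (Leaf ())"
| "split_leaf ((_, b) # p) i (Query j l r) =
     (if b then Query j l (split_leaf p i r) else Query j (split_leaf p i l) r)"
| "split_leaf _ _ T = T"

text \<open>
  One iteration of the while loop. Every way of breaking ties, both in the choice \<open>v p\<close> of a most
  influential variable at each leaf and in the choice of a highest-score leaf, gives a possible
  successor.
\<close>

inductive topdown_step ::
    "nat \<Rightarrow> ((nat \<Rightarrow> bool) \<Rightarrow> real) \<Rightarrow> real \<Rightarrow> unit dtree \<Rightarrow> unit dtree \<Rightarrow> bool"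
  for n f \<epsilon> where
  "topdown_step n f \<epsilon> T (split_leaf p\<^sub>0 (v p\<^sub>0) T)"
  if "\<not> approximates n \<epsilon> f (completion n f T)"
    and "\<forall>p\<in>leaves T. is_arg_max (\<lambda>i. influence n i (restrict_path f p)) (\<lambda>i. i < n) (v p)"
    and "is_arg_max (\<lambda>p. (1/2) ^ length p * influence n (v p) (restrict_path f p))
           (\<lambda>p. p \<in> leaves T) p\<^sub>0"

definition topdown_output ::
    "nat \<Rightarrow> ((nat \<Rightarrow> bool) \<Rightarrow> real) \<Rightarrow> real \<Rightarrow> real dtree \<Rightarrow> bool" where
  "topdown_output n f \<epsilon> U \<longleftrightarrow>
     (\<exists>T. (topdown_step n f \<epsilon>)\<^sup>*\<^sup>* (Leaf ()) T \<and>
          approximates n \<epsilon> f (completion n f T) \<and> U = completion n f T)"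

text \<open>
  Whatever the tie-breaking, the loop started at \<open>T\<close> exits after finitely many iterations with
  an output: it neither runs forever nor gets stuck.
\<close>

inductive topdown_halts ::
    "nat \<Rightarrow> ((nat \<Rightarrow> bool) \<Rightarrow> real) \<Rightarrow> real \<Rightarrow> unit dtree \<Rightarrow> bool"
  for n f \<epsilon> where
  exit: "topdown_halts n f \<epsilon> T" if "approximates n \<epsilon> f (completion n f T)"
| iterate: "topdown_halts n f \<epsilon> T"
    if "\<exists>T'. topdown_step n f \<epsilon> T T'"
      and "\<forall>T'. topdown_step n f \<epsilon> T T' \<longrightarrow> topdown_halts n f \<epsilon> T'"

end

theory Submission
  imports Defs
begin

text \<open>
  The potential of a bare tree is the average, over its leaves, of the total influence of the
  restricted function. Splitting a leaf lowers it by exactly the score of that leaf. The OSSS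
  inequality \<open>Var g \<le> max\<^sub>i Inf\<^sub>i g \<cdot> log s\<close> shows that, while the error exceeds \<open>\<epsilon>\<close>, some leaf of a tree
  of size \<open>m\<close> has score at least \<open>2 \<epsilon> / (m log s)\<close>. The potential starts at the total influence of
  \<open>f\<close>, which is at most \<open>sqrt (log s)\<close> because \<open>f\<close> is monotone. Summing the harmonic series bounds
  \<open>ln m\<close> by \<open>(log s) powr (3/2) / (2 \<epsilon>)\<close>.
\<close>

section \<open>Expectations on the cube\<close>

abbreviation cube_expectation :: "nat \<Rightarrow> ((nat \<Rightarrow> bool) \<Rightarrow> real) \<Rightarrow> real" where
  "cube_expectation n g \<equiv> measure_pmf.expectation (unif n) g"

lemma finite_cube [simp]: "finite (cube n)"
  by (simp add: cube_def finite_PiE)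

lemma cube_nonempty [simp]: "cube n \<noteq> {}"
  by (simp add: cube_def PiE_eq_empty_iff)

lemma cube_upd [simp]: "x \<in> cube n \<Longrightarrow> i < n \<Longrightarrow> x(i := b) \<in> cube n"
  by (auto simp: cube_def PiE_iff extensional_def)

lemma cube_expectation_eq_sum: "cube_expectation n g = sum g (cube n) / card (cube n)"
  by (simp add: integral_pmf_of_set)

lemma cube_expectation_cong:
  "(\<And>x. x \<in> cube n \<Longrightarrow> g x = h x) \<Longrightarrow> cube_expectation n g = cube_expectation n h"
  unfolding cube_expectation_eq_sum by (simp cong: sum.cong)

lemma cube_expectation_add:
  "cube_expectation n (\<lambda>x. g x + h x) = cube_expectation n g + cube_expectation n h"
  unfolding cube_expectation_eq_sum by (simp add: sum.distrib add_divide_distrib)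

lemma cube_expectation_diff:
  "cube_expectation n (\<lambda>x. g x - h x) = cube_expectation n g - cube_expectation n h"
  unfolding cube_expectation_eq_sum by (simp add: sum_subtractf diff_divide_distrib)

lemma cube_expectation_sum:
  "cube_expectation n (\<lambda>x. \<Sum>j\<in>J. g j x) = (\<Sum>j\<in>J. cube_expectation n (g j))"
  unfolding cube_expectation_eq_sum
  by (subst sum.swap) (simp add: sum_divide_distrib)

lemma cube_expectation_mono:
  "(\<And>x. x \<in> cube n \<Longrightarrow> g x \<le> h x) \<Longrightarrow> cube_expectation n g \<le> cube_expectation n h"
  unfolding cube_expectation_eq_sum by (intro divide_right_mono sum_mono) auto

lemma cube_expectation_abs_le:
  assumes "\<And>x. x \<in> cube n \<Longrightarrow> \<bar>g x\<bar> \<le> h x"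
  shows "\<bar>cube_expectation n g\<bar> \<le> cube_expectation n h"
proof -
  have "cube_expectation n g \<le> cube_expectation n h"
    using assms by (intro cube_expectation_mono) (fastforce simp: abs_le_iff)
  moreover have "cube_expectation n (\<lambda>x. - g x) \<le> cube_expectation n h"
    using assms by (intro cube_expectation_mono) (fastforce simp: abs_le_iff)
  ultimately show ?thesis
    by (simp add: abs_le_iff)
qed

lemma prob_eq_cube_expectation:
  "measure_pmf.prob (unif n) {x. P x} = cube_expectation n (\<lambda>x. of_bool (P x))"
proof -
  have "(\<Sum>x\<in>cube n. of_bool (P x)) = real (card (cube n \<inter> {x. P x}))"
    by (simp add: of_bool_def sum.If_cases)
  then show ?thesis
    by (simp add: measure_pmf_of_set cube_expectation_eq_sum)
qed

text \<open>Flipping coordinate \<open>i\<close> is an involution of the cube, so \<open>g\<close>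
  and its flip have the same mean; pairing \<open>x\<close> with its flip gives both settings of
  coordinate \<open>i\<close>. This conditioning on one bit drives the later inductions over
  trees.\<close>

lemma cube_expectation_split:
  assumes "i < n"
  shows "cube_expectation n g =
    (cube_expectation n (\<lambda>x. g (x(i := False))) + cube_expectation n (\<lambda>x. g (x(i := True)))) / 2"
proof -
  let ?flip = "\<lambda>x. x(i := \<not> x i)"
  have "bij_betw ?flip (cube n) (cube n)"
    by (rule bij_betw_byWitness[where f' = ?flip]) (use assms in auto)
  then have flip: "cube_expectation n (\<lambda>x. g (?flip x)) = cube_expectation n g"
    unfolding cube_expectation_eq_sum using sum.reindex_bij_betw[of ?flip _ _ g] by simp
  have "g x + g (?flip x) = g (x(i := False)) + g (x(i := True))" for x
    by (cases "x i") (simp_all add: fun_upd_idem)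
  then have "cube_expectation n (\<lambda>x. g x + g (?flip x)) =
      cube_expectation n (\<lambda>x. g (x(i := False)) + g (x(i := True)))"
    by simp
  then show ?thesis
    unfolding cube_expectation_add flip by simp
qed

section \<open>Influences\<close>

lemma influence_nonneg: "influence n i g \<ge> 0"
  by (simp add: influence_def)

text \<open>For values in {-1, 1} the difference along an edge is 0 or has absolute value 2, so half
  of it is the indicator that the edge is sensitive.\<close>

lemma influence_eq_abs:
  assumes "g \<in> cube n \<rightarrow> {-1, 1}" "i < n"
  shows "influence n i g =
    cube_expectation n (\<lambda>x. \<bar>g (x(i := True)) - g (x(i := False))\<bar> / 2)"
  unfolding influence_def prob_eq_cube_expectation
proof (rule cube_expectation_cong)
  fix x assume x: "x \<in> cube n"
  have "g (x(i := b)) = -1 \<or> g (x(i := b)) = 1" for b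
    using cube_upd[OF x \<open>i < n\<close>, of b] assms(1) by auto
  from this[of True] this[of False]
  show "of_bool (g x \<noteq> g (x(i := \<not> x i))) = \<bar>g (x(i := True)) - g (x(i := False))\<bar> / 2"
    by (cases "x i") (auto simp: fun_upd_idem)
qed

lemma influence_restrict_same [simp]: "influence n i (\<lambda>x. g (x(i := b))) = 0"
  by (simp add: influence_def)

text \<open>Fixing \<open>v\<close> commutes with flipping \<open>j\<close> when the two differ, so
  it suffices to condition on coordinate \<open>v\<close>.\<close>

lemma influence_restrict_avg:
  assumes "v < n" "j \<noteq> v"
  shows "influence n j g =
    (influence n j (\<lambda>x. g (x(v := False))) + influence n j (\<lambda>x. g (x(v := True)))) / 2"
  unfolding influence_def prob_eq_cube_expectation
  by (subst cube_expectation_split[OF \<open>v < n\<close>]) (use assms in \<open>simp add: fun_upd_twist\<close>)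

definition total_influence :: "nat \<Rightarrow> ((nat \<Rightarrow> bool) \<Rightarrow> real) \<Rightarrow> real" where
  "total_influence n g = (\<Sum>i<n. influence n i g)"

lemma total_influence_nonneg: "total_influence n g \<ge> 0"
  by (simp add: total_influence_def influence_nonneg sum_nonneg)

text \<open>Querying \<open>v\<close> kills its own influence in both halves and preserves the
  average of every other influence. This is why a split lowers the potential by exactly the
  score.\<close>

lemma total_influence_restrict_avg:
  assumes "v < n"
  shows "(total_influence n (\<lambda>x. g (x(v := False))) + total_influence n (\<lambda>x. g (x(v := True)))) / 2
    = total_influence n g - influence n v g"
proof -
  let ?g = "\<lambda>b x. g (x(v := b))"
  have rm: "total_influence n h = influence n v h + (\<Sum>j\<in>{..<n} - {v}. influence n j h)" for h
    unfolding total_influence_def using assms by (intro sum.remove) auto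
  have "(\<Sum>j\<in>{..<n} - {v}. influence n j g) =
      (\<Sum>j\<in>{..<n} - {v}. (influence n j (?g False) + influence n j (?g True)) / 2)"
    by (intro sum.cong refl influence_restrict_avg[OF assms]) auto
  then show ?thesis
    unfolding rm[of g] rm[of "?g False"] rm[of "?g True"]
    by (simp add: sum.distrib flip: sum_divide_distrib)
qed

section \<open>Read-once decision trees\<close>

text \<open>Without repeated queries on a path, a leaf of depth d is reached with probability
  \<open>(1/2) ^ d\<close>, and a subtree ignores the variables queried above it.\<close>

fun read_once :: "'l dtree \<Rightarrow> bool" where
  "read_once (Leaf b) = True"
| "read_once (Query i l r) \<longleftrightarrow>
     i \<notin> queried_vars l \<and> i \<notin> queried_vars r \<and> read_once l \<and> read_once r"

fun restrict_dt :: "nat \<Rightarrow> bool \<Rightarrow> 'l dtree \<Rightarrow> 'l dtree" where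
  "restrict_dt i b (Leaf c) = Leaf c"
| "restrict_dt i b (Query j l r) =
     (if j = i then (if b then restrict_dt i b r else restrict_dt i b l)
      else Query j (restrict_dt i b l) (restrict_dt i b r))"

text \<open>The subtrees are cleaned first and restricted afterwards, which keeps the recursion
  structural; restriction preserves \<open>read_once\<close>.\<close>

fun remove_requeries :: "'l dtree \<Rightarrow> 'l dtree" where
  "remove_requeries (Leaf c) = Leaf c"
| "remove_requeries (Query i l r) =
     Query i (restrict_dt i False (remove_requeries l)) (restrict_dt i True (remove_requeries r))"

text \<open>For a read-once tree this is the expected number of queries on a uniform input.\<close>

fun avg_depth :: "'l dtree \<Rightarrow> real" where
  "avg_depth (Leaf c) = 0"
| "avg_depth (Query i l r) = 1 + (avg_depth l + avg_depth r) / 2"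

lemma eval_restrict_dt [simp]: "eval_dt (restrict_dt i b T) x = eval_dt T (x(i := b))"
  by (induction T) auto

lemma queried_vars_restrict_dt: "queried_vars (restrict_dt i b T) \<subseteq> queried_vars T - {i}"
  by (induction T) auto

lemma leaf_labels_restrict_dt: "leaf_labels (restrict_dt i b T) \<subseteq> leaf_labels T"
  by (induction T) auto

lemma dt_size_restrict_dt: "dt_size (restrict_dt i b T) \<le> dt_size T"
  by (induction T) auto

lemma read_once_restrict_dt: "read_once T \<Longrightarrow> read_once (restrict_dt i b T)"
  by (induction T) (use queried_vars_restrict_dt in fastforce)+

lemma eval_remove_requeries [simp]: "eval_dt (remove_requeries T) x = eval_dt T x"
  by (induction T arbitrary: x) (auto simp: fun_upd_idem)

lemma queried_vars_remove_requeries: "queried_vars (remove_requeries T) \<subseteq> queried_vars T"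
  by (induction T) (use queried_vars_restrict_dt in fastforce)+

lemma leaf_labels_remove_requeries: "leaf_labels (remove_requeries T) \<subseteq> leaf_labels T"
  by (induction T) (use leaf_labels_restrict_dt in fastforce)+

lemma dt_size_remove_requeries: "dt_size (remove_requeries T) \<le> dt_size T"
  by (induction T) (auto intro!: add_mono intro: order_trans[OF dt_size_restrict_dt])

lemma read_once_remove_requeries: "read_once (remove_requeries T)"
  by (induction T) (use queried_vars_restrict_dt in \<open>fastforce simp: read_once_restrict_dt\<close>)+

lemma dt_size_pos: "dt_size T > 0"
  by (induction T) auto

lemma eval_dt_upd_unqueried [simp]: "i \<notin> queried_vars T \<Longrightarrow> eval_dt T (x(i := b)) = eval_dt T x"
  by (induction T) auto

lemma eval_dt_in_leaf_labels: "eval_dt T x \<in> leaf_labels T"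
  by (induction T) auto

lemma avg_depth_nonneg: "avg_depth T \<ge> 0"
  by (induction T) auto

text \<open>Induction with the AM-GM inequality: 4ab \<le> (a + b)^2 for the subtree sizes a and b
  absorbs the 1 contributed by the root.\<close>

lemma avg_depth_le_log_size: "avg_depth T \<le> log 2 (dt_size T)"
proof (induction T)
  case (Query i l r)
  define a b where "a = real (dt_size l)" and "b = real (dt_size r)"
  have pos: "a > 0" "b > 0"
    by (simp_all add: a_def b_def dt_size_pos)
  have "avg_depth (Query i l r) \<le> 1 + (log 2 a + log 2 b) / 2"
    using Query.IH unfolding a_def b_def avg_depth.simps
    by (intro add_mono divide_right_mono) auto
  also have "\<dots> = log 2 (4 * (a * b)) / 2"
  proof -
    have "log 2 (4 * (a * b)) = log 2 (2 ^ 2) + (log 2 a + log 2 b)"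
      using pos by (simp add: log_mult)
    then show ?thesis
      by (simp only: log_pow_cancel) simp
  qed
  also have "\<dots> \<le> log 2 ((a + b)\<^sup>2) / 2"
  proof -
    have "4 * (a * b) \<le> (a + b)\<^sup>2"
      using sum_squares_ge_zero[of "a - b" 0] by (simp add: power2_eq_square algebra_simps)
    then show ?thesis
      using pos by (simp add: divide_right_mono)
  qed
  also have "\<dots> = log 2 (a + b)"
    using pos by (simp add: log_nat_power)
  finally show ?case
    by (simp only: a_def b_def dt_size.simps of_nat_add)
qed auto

section \<open>The OSSS inequality\<close>

text \<open>A form of OSSS with all influences bounded by \<open>M\<close>. Only the tree is
  decomposed while \<open>g\<close> stays unrestricted, so the same \<open>M\<close> serves in both
  subtrees. Each query changes the covariance by at most \<open>M\<close>, and averaging over the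
  branches counts the queries by \<open>avg_depth\<close>.\<close>

lemma abs_covariance_le_avg_depth:
  assumes g: "g \<in> cube n \<rightarrow> {-1, 1}" and M: "\<And>i. i < n \<Longrightarrow> influence n i g \<le> M"
    and "read_once T" "queried_vars T \<subseteq> {..<n}" "leaf_labels T \<subseteq> {-1, 1}"
  shows "\<bar>cube_expectation n (\<lambda>x. g x * eval_dt T x) -
      cube_expectation n g * cube_expectation n (eval_dt T)\<bar> \<le> M * avg_depth T"
  using assms(3-)
proof (induction T)
  case (Leaf c)
  then show ?case
    by simp
next
  case (Query i l r)
  let ?E = "cube_expectation n" and ?U = "\<lambda>b. if b then r else l"
  let ?cov = "\<lambda>T. ?E (\<lambda>x. g x * eval_dt T x) - ?E g * ?E (eval_dt T)"
  have i: "i < n" and il: "i \<notin> queried_vars l" and ir: "i \<notin> queried_vars r"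
    using Query.prems by auto
  have labels: "\<bar>eval_dt l x\<bar> = 1" "\<bar>eval_dt r x\<bar> = 1" for x
    using eval_dt_in_leaf_labels[of l x] eval_dt_in_leaf_labels[of r x] Query.prems by auto
  \<comment> \<open>The correction due to the root: the product of the differences of
    \<open>g\<close> and of the tree in direction \<open>i\<close>, over 4. The tree differs by at
    most 2, so \<open>d\<close> is bounded by the influence of \<open>i\<close> on
    \<open>g\<close>.\<close>
  define d where "d = ?E (\<lambda>x. (g (x(i := True)) - g (x(i := False))) * (eval_dt r x - eval_dt l x) / 4)"
  have mean: "?E (eval_dt (Query i l r)) = (?E (eval_dt l) + ?E (eval_dt r)) / 2"
    by (subst cube_expectation_split[OF i]) (simp add: il ir)
  have "?E (\<lambda>x. g x * eval_dt (Query i l r) x) =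
      (?E (\<lambda>x. g x * eval_dt l x) + ?E (\<lambda>x. g x * eval_dt r x)) / 2 + d"
    unfolding d_def
    by (subst (1 2 3) cube_expectation_split[OF i])
      (simp add: il ir algebra_simps add_divide_distrib diff_divide_distrib
        cube_expectation_add cube_expectation_diff)
  then have cov: "?cov (Query i l r) = (?cov l + ?cov r) / 2 + d"
    unfolding mean by (simp only: ring_distribs) (simp add: field_simps)
  have "\<bar>d\<bar> \<le> ?E (\<lambda>x. \<bar>g (x(i := True)) - g (x(i := False))\<bar> / 2)"
    unfolding d_def
  proof (rule cube_expectation_abs_le)
    fix x
    have "\<bar>eval_dt r x - eval_dt l x\<bar> \<le> 2"
      using labels[of x] by linarith
    from mult_left_mono[OF this abs_ge_zero[of "g (x(i := True)) - g (x(i := False))"]]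
    show "\<bar>(g (x(i := True)) - g (x(i := False))) * (eval_dt r x - eval_dt l x) / 4\<bar>
        \<le> \<bar>g (x(i := True)) - g (x(i := False))\<bar> / 2"
      unfolding abs_mult abs_divide abs_numeral by linarith
  qed
  also have "\<dots> \<le> M"
    using M[OF i] by (simp only: influence_eq_abs[OF g i])
  finally have "\<bar>d\<bar> \<le> M" .
  moreover have "\<bar>?cov l\<bar> \<le> M * avg_depth l" "\<bar>?cov r\<bar> \<le> M * avg_depth r"
    using Query by auto
  moreover have "\<bar>(a + b) / 2 + d\<bar> \<le> (A + B) / 2 + M"
    if "\<bar>d\<bar> \<le> M" "\<bar>a\<bar> \<le> A" "\<bar>b\<bar> \<le> B" for a b A B :: real
    using that by (simp add: abs_le_iff field_simps)
  ultimately have "\<bar>?cov (Query i l r)\<bar> \<le> (M * avg_depth l + M * avg_depth r) / 2 + M"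
    unfolding cov by blast
  also have "\<dots> = M * avg_depth (Query i l r)"
    by (simp add: algebra_simps add_divide_distrib)
  finally show ?case .
qed

text \<open>Size at most \<open>s\<close>, not equal to \<open>s\<close>: restricting a tree or
  removing repeated queries may shrink it, and the property must pass to all restrictions of
  \<open>f\<close>.\<close>

definition computed_by_read_once :: "nat \<Rightarrow> ((nat \<Rightarrow> bool) \<Rightarrow> real) \<Rightarrow> nat \<Rightarrow> bool" where
  "computed_by_read_once n g s \<longleftrightarrow>
     (\<exists>T. read_once T \<and> queried_vars T \<subseteq> {..<n} \<and> leaf_labels T \<subseteq> {-1, 1} \<and> dt_size T \<le> s \<and>
          (\<forall>x\<in>cube n. eval_dt T x = g x))"

lemma computed_by_read_once_if_computable:
  assumes "computable_by_dt_of_size n f s"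
  shows "computed_by_read_once n f s"
proof -
  obtain T where T: "queried_vars T \<subseteq> {..<n}" "leaf_labels T \<subseteq> {-1, 1}" "dt_size T = s"
      "\<forall>x\<in>cube n. eval_dt T x = f x"
    using assms unfolding computable_by_dt_of_size_def by blast
  show ?thesis
    unfolding computed_by_read_once_def
    using T queried_vars_remove_requeries[of T] leaf_labels_remove_requeries[of T]
      dt_size_remove_requeries[of T] read_once_remove_requeries[of T]
    by (intro exI[of _ "remove_requeries T"]) auto
qed

lemma computed_by_read_once_restrict:
  assumes "computed_by_read_once n g s" "i < n"
  shows "computed_by_read_once n (\<lambda>x. g (x(i := b))) s"
proof -
  obtain T where T: "read_once T" "queried_vars T \<subseteq> {..<n}" "leaf_labels T \<subseteq> {-1, 1}"
      "dt_size T \<le> s" "\<forall>x\<in>cube n. eval_dt T x = g x"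
    using assms unfolding computed_by_read_once_def by blast
  show ?thesis
    unfolding computed_by_read_once_def
    using T assms(2) queried_vars_restrict_dt[of i b T] leaf_labels_restrict_dt[of i b T]
      dt_size_restrict_dt[of i b T] read_once_restrict_dt[of T i b]
    by (intro exI[of _ "restrict_dt i b T"]) auto
qed

lemma computed_by_read_once_restrict_path:
  assumes "computed_by_read_once n g s" "fst ` set p \<subseteq> {..<n}"
  shows "computed_by_read_once n (restrict_path g p) s"
  using assms
  by (induction g p rule: restrict_path.induct) (auto simp: computed_by_read_once_restrict)

lemma computed_by_read_once_pm:
  assumes "computed_by_read_once n g s"
  shows "g \<in> cube n \<rightarrow> {-1, 1}"
  using assms eval_dt_in_leaf_labels unfolding computed_by_read_once_def by (metis Pi_I subsetD)

text \<open>The covariance bound is applied to a tree that computes \<open>g\<close> itself. Since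
  \<open>g\<close> squares to 1, the covariance becomes the variance of \<open>g\<close>.\<close>

lemma variance_le_max_influence_log_size:
  assumes "computed_by_read_once n g s" and M: "\<And>i. i < n \<Longrightarrow> influence n i g \<le> M" and "0 \<le> M"
  shows "1 - (cube_expectation n g)\<^sup>2 \<le> M * log 2 s"
proof -
  have g: "g \<in> cube n \<rightarrow> {-1, 1}"
    by (rule computed_by_read_once_pm[OF assms(1)])
  obtain T where T: "read_once T" "queried_vars T \<subseteq> {..<n}" "leaf_labels T \<subseteq> {-1, 1}"
      "dt_size T \<le> s" "\<And>x. x \<in> cube n \<Longrightarrow> eval_dt T x = g x"
    using assms(1) unfolding computed_by_read_once_def by blast
  have "cube_expectation n (\<lambda>x. g x * eval_dt T x) = cube_expectation n (\<lambda>x. 1)"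
  proof (rule cube_expectation_cong)
    fix x assume x: "x \<in> cube n"
    then have "g x = -1 \<or> g x = 1"
      using g by auto
    then show "g x * eval_dt T x = 1"
      using T(5)[OF x] by auto
  qed
  moreover have "cube_expectation n (eval_dt T) = cube_expectation n g"
    by (rule cube_expectation_cong) (use T(5) in simp)
  ultimately have "1 - (cube_expectation n g)\<^sup>2 \<le> M * avg_depth T"
    using abs_covariance_le_avg_depth[OF g M T(1-3)]
    by (simp add: power2_eq_square)
  also have "avg_depth T \<le> log 2 s"
    using avg_depth_le_log_size[of T] T(4) dt_size_pos[of T]
    by (smt (verit) log_le_cancel_iff of_nat_0_less_iff of_nat_mono)
  finally show ?thesis
    using \<open>0 \<le> M\<close> by (simp add: mult_left_mono)
qed

section \<open>Total influence of monotone functions\<close>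

text \<open>The degree-one character of coordinate \<open>i\<close>, up to sign.\<close>

definition spin :: "nat \<Rightarrow> (nat \<Rightarrow> bool) \<Rightarrow> real" where
  "spin i x = (if x i then 1 else -1)"

lemma spin_upd: "spin j (x(i := b)) = (if j = i then if b then 1 else -1 else spin j x)"
  by (simp add: spin_def)

text \<open>Monotonicity makes every edge difference nonnegative, so the absolute value disappears
  and the influence becomes linear in \<open>g\<close>: a level-one Fourier coefficient.\<close>

lemma influence_eq_spin_correlation:
  assumes "g \<in> cube n \<rightarrow> {-1, 1}" "mono_on (cube n) g" "i < n"
  shows "influence n i g = cube_expectation n (\<lambda>x. g x * spin i x)"
proof -
  have "g (x(i := False)) \<le> g (x(i := True))" if "x \<in> cube n" for x
    using that assms(3) by (intro mono_onD[OF assms(2)]) (auto simp: le_fun_def)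
  then have "influence n i g = cube_expectation n (\<lambda>x. (g (x(i := True)) - g (x(i := False))) / 2)"
    unfolding influence_eq_abs[OF assms(1,3)] by (intro cube_expectation_cong) simp
  also have "\<dots> = cube_expectation n (\<lambda>x. g x * spin i x)"
    by (subst (2) cube_expectation_split[OF assms(3)])
      (simp add: spin_upd cube_expectation_diff diff_divide_distrib)
  finally show ?thesis .
qed

lemma average_sqrt_le:
  assumes "a \<ge> 0" "b \<ge> 0"
  shows "(sqrt a + sqrt b) / 2 \<le> sqrt ((a + b) / 2)"
proof (rule real_le_rsqrt)
  have "(sqrt a - sqrt b)\<^sup>2 \<ge> 0"
    by simp
  then show "((sqrt a + sqrt b) / 2)\<^sup>2 \<le> (a + b) / 2"
    using assms by (simp add: power2_sum power2_diff power_divide field_simps)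
qed

text \<open>
  The left-hand side is the expectation of \<open>T(x) (t + S)\<close>, where \<open>S\<close> is the sum of the spins queried
  on \<open>x\<close>. The offset \<open>t\<close> records the spins already read, which makes the induction go through.
\<close>

lemma offset_spin_correlation_le:
  assumes "read_once T" "queried_vars T \<subseteq> {..<n}" "leaf_labels T \<subseteq> {-1, 1}"
  shows "cube_expectation n (\<lambda>x. eval_dt T x * (t + (\<Sum>j<n. spin j x))) \<le> sqrt (t\<^sup>2 + avg_depth T)"
  using assms
proof (induction T arbitrary: t)
  case (Leaf c)
  have "cube_expectation n (spin j) = 0" if "j < n" for j
    by (subst cube_expectation_split[OF that]) (simp add: spin_upd)
  then have "cube_expectation n (\<lambda>x. c * (t + (\<Sum>j<n. spin j x))) = c * t"
    by (simp add: cube_expectation_add cube_expectation_sum)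
  then show ?case
    \<comment> \<open>The label is a sign, so the value is at most |t|, the square root of
      t^2.\<close>
    using Leaf.prems by (auto simp: abs_if)
next
  case (Query i l r)
  have i: "i < n" and il: "i \<notin> queried_vars l" and ir: "i \<notin> queried_vars r"
    using Query.prems by auto
  let ?E = "cube_expectation n"
  let ?X = "\<lambda>x. \<Sum>j<n. spin j x" and ?Y = "\<lambda>x. \<Sum>j\<in>{..<n} - {i}. spin j x"
  have X: "?X x = spin i x + ?Y x" for x
    using i by (intro sum.remove) auto
  have Y: "?Y (x(i := b)) = ?Y x" for x b
    by (intro sum.cong) (auto simp: spin_upd)
  have spin_i: "spin i (x(i := False)) = -1" "spin i (x(i := True)) = 1" for x
    by (simp_all add: spin_upd)
  have Y_only: "?E (\<lambda>x. eval_dt T x * (u + ?X x)) = ?E (\<lambda>x. eval_dt T x * (u + ?Y x))"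
    if "i \<notin> queried_vars T" for T u
  proof -
    have "?E (\<lambda>x. eval_dt T x * (u + ?X x)) =
        (?E (\<lambda>x. eval_dt T x * (u + (-1 + ?Y x))) + ?E (\<lambda>x. eval_dt T x * (u + (1 + ?Y x)))) / 2"
      unfolding X by (subst cube_expectation_split[OF i]) (simp add: that Y spin_i)
    also have "\<dots> = ?E (\<lambda>x. eval_dt T x * (u + ?Y x))"
      by (simp add: algebra_simps cube_expectation_add cube_expectation_diff)
    finally show ?thesis .
  qed
  \<comment> \<open>The answer at the root shifts the offset to \<open>t - 1\<close> or
    \<open>t + 1\<close>. The spin of \<open>i\<close> is then put back, because the induction
    hypotheses sum over all coordinates.\<close>
  have "?E (\<lambda>x. eval_dt (Query i l r) x * (t + ?X x)) =
      (?E (\<lambda>x. eval_dt l x * (t - 1 + ?Y x)) + ?E (\<lambda>x. eval_dt r x * (t + 1 + ?Y x))) / 2"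
    unfolding X by (subst cube_expectation_split[OF i]) (simp add: il ir Y spin_i algebra_simps)
  also have "\<dots> = (?E (\<lambda>x. eval_dt l x * (t - 1 + ?X x)) + ?E (\<lambda>x. eval_dt r x * (t + 1 + ?X x))) / 2"
    by (simp only: Y_only il ir not_False_eq_True)
  also have "\<dots> \<le> (sqrt ((t - 1)\<^sup>2 + avg_depth l) + sqrt ((t + 1)\<^sup>2 + avg_depth r)) / 2"
    using Query.IH(1)[of "t - 1"] Query.IH(2)[of "t + 1"] Query.prems by simp
  also have "\<dots> \<le> sqrt (((t - 1)\<^sup>2 + avg_depth l + ((t + 1)\<^sup>2 + avg_depth r)) / 2)"
    by (intro average_sqrt_le add_nonneg_nonneg avg_depth_nonneg) auto
  \<comment> \<open>The cross terms cancel, and the squares leave the 1 that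
    \<open>avg_depth\<close> counts for the root.\<close>
  also have "((t - 1)\<^sup>2 + avg_depth l + ((t + 1)\<^sup>2 + avg_depth r)) / 2 =
      t\<^sup>2 + avg_depth (Query i l r)"
    by (simp add: power2_eq_square field_simps)
  finally show ?case .
qed

text \<open>For monotone \<open>g\<close> the influences add up to the correlation of
  \<open>g\<close> with the sum of all spins, which the preceding bound controls at offset
  0.\<close>

lemma total_influence_mono_le:
  assumes "computed_by_read_once n g s" "mono_on (cube n) g"
  shows "total_influence n g \<le> sqrt (log 2 s)"
proof -
  have g: "g \<in> cube n \<rightarrow> {-1, 1}"
    by (rule computed_by_read_once_pm[OF assms(1)])
  obtain T where T: "read_once T" "queried_vars T \<subseteq> {..<n}" "leaf_labels T \<subseteq> {-1, 1}"
      "dt_size T \<le> s" "\<And>x. x \<in> cube n \<Longrightarrow> eval_dt T x = g x"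
    using assms(1) unfolding computed_by_read_once_def by blast
  have "total_influence n g = (\<Sum>i<n. cube_expectation n (\<lambda>x. g x * spin i x))"
    unfolding total_influence_def
    by (intro sum.cong refl influence_eq_spin_correlation[OF g assms(2)]) simp
  also have "\<dots> = cube_expectation n (\<lambda>x. g x * (0 + (\<Sum>i<n. spin i x)))"
    by (simp add: sum_distrib_left cube_expectation_sum)
  also have "\<dots> = cube_expectation n (\<lambda>x. eval_dt T x * (0 + (\<Sum>i<n. spin i x)))"
    by (rule cube_expectation_cong) (simp add: T(5))
  also have "\<dots> \<le> sqrt (avg_depth T)"
    using offset_spin_correlation_le[OF T(1-3), of 0] by simp
  also have "\<dots> \<le> sqrt (log 2 s)"
    using avg_depth_le_log_size[of T] T(4) dt_size_pos[of T]
    by (smt (verit) log_le_cancel_iff of_nat_0_less_iff of_nat_mono real_sqrt_le_iff)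
  finally show ?thesis .
qed

section \<open>Averages over the leaves of a bare tree\<close>

lemma restrict_path_append: "restrict_path f (p @ q) = restrict_path (restrict_path f p) q"
  by (induction f p rule: restrict_path.induct) auto

lemma finite_leaves [simp]: "finite (leaves T)"
  by (induction T) auto

lemma leaves_nonempty [simp]: "leaves T \<noteq> {}"
  by (induction T) auto

lemma card_leaves: "card (leaves T) = dt_size T"
proof (induction T)
  case (Query i l r)
  have "card (leaves (Query i l r)) = card (Cons (i, False) ` leaves l) + card (Cons (i, True) ` leaves r)"
    unfolding leaves.simps by (intro card_Un_disjoint) auto
  with Query show ?case
    by (simp add: card_image)
qed auto

lemma leaves_queried_vars: "p \<in> leaves T \<Longrightarrow> fst ` set p \<subseteq> queried_vars T"
  by (induction T arbitrary: p) fastforce+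

text \<open>In a read-once tree the weight of a leaf is the probability that a uniform input reaches
  it.\<close>

definition leaf_avg :: "(path \<Rightarrow> real) \<Rightarrow> 'l dtree \<Rightarrow> real" where
  "leaf_avg h T = (\<Sum>p\<in>leaves T. (1/2) ^ length p * h p)"

lemma leaf_avg_Leaf [simp]: "leaf_avg h (Leaf c) = h []"
  by (simp add: leaf_avg_def)

lemma leaf_avg_Query [simp]:
  "leaf_avg h (Query i l r) =
    (leaf_avg (\<lambda>p. h ((i, False) # p)) l + leaf_avg (\<lambda>p. h ((i, True) # p)) r) / 2"
proof -
  have "leaf_avg h (Query i l r) =
      (\<Sum>p\<in>Cons (i, False) ` leaves l. (1/2) ^ length p * h p) +
      (\<Sum>p\<in>Cons (i, True) ` leaves r. (1/2) ^ length p * h p)"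
    unfolding leaf_avg_def leaves.simps by (intro sum.union_disjoint) auto
  then show ?thesis
    by (simp add: leaf_avg_def sum.reindex sum_divide_distrib add_divide_distrib)
qed

lemma leaf_avg_mono:
  "(\<And>p. p \<in> leaves T \<Longrightarrow> h p \<le> k p) \<Longrightarrow> leaf_avg h T \<le> leaf_avg k T"
  unfolding leaf_avg_def by (intro sum_mono mult_left_mono) auto

text \<open>Only the term of \<open>p\<close> changes: two children of half its weight replace
  it.\<close>

lemma leaf_avg_split_leaf:
  assumes "p \<in> leaves T"
  shows "leaf_avg h (split_leaf p i T) =
    leaf_avg h T - (1/2) ^ length p * (h p - (h (p @ [(i, False)]) + h (p @ [(i, True)])) / 2)"
  using assms
proof (induction p i T arbitrary: h rule: split_leaf.induct)
  case (2 j b p i k l r)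
  then show ?case
    by (cases b) auto
qed auto

lemma dt_size_split_leaf: "p \<in> leaves T \<Longrightarrow> dt_size (split_leaf p i T) = Suc (dt_size T)"
  by (induction p i T rule: split_leaf.induct) auto

lemma queried_vars_split_leaf: "queried_vars (split_leaf p i T) \<subseteq> insert i (queried_vars T)"
  by (induction p i T rule: split_leaf.induct) auto

lemma read_once_split_leaf:
  assumes "p \<in> leaves T" "i \<notin> fst ` set p" "read_once T"
  shows "read_once (split_leaf p i T)"
  using assms
proof (induction p i T rule: split_leaf.induct)
  case (2 j b p i k l r)
  then show ?case
    using queried_vars_split_leaf[of p i l] queried_vars_split_leaf[of p i r] by auto
qed auto

text \<open>A restricted function ignores the coordinates fixed by the path. Hence a split with
  positive score queries a fresh variable, which keeps the trees of a run read-once.\<close>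

lemma influence_restrict_path_fixed:
  assumes "i \<in> fst ` set p"
  shows "influence n i (restrict_path f p) = 0"
proof -
  have "restrict_path f p (x(i := c)) = restrict_path f p x" for x c
    using assms
  proof (induction f p arbitrary: x rule: restrict_path.induct)
    case (2 f j b p)
    \<comment> \<open>Once a function ignores coordinate \<open>i\<close>, restricting it along the
      rest of the path cannot bring the dependence back.\<close>
    have *: "restrict_path g p (x(i := c)) = restrict_path g p x"
      if "\<And>x. g (x(i := c)) = g x" for g :: "(nat \<Rightarrow> bool) \<Rightarrow> 'a" and x
      using that
    proof (induction g p arbitrary: x rule: restrict_path.induct)
      case (2 g k d q)
      have "g (x(i := c, k := d)) = g (x(k := d))" for x
        using 2(2)[of "x(k := d)"] by (cases "k = i") (simp, metis fun_upd_twist)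
      then show ?case
        unfolding restrict_path.simps by (rule 2(1))
    qed auto
    show ?case
    proof (cases "i = j")
      case True
      then show ?thesis
        unfolding restrict_path.simps by (intro *) simp
    qed (use 2 in auto)
  qed auto
  then show ?thesis
    by (simp add: influence_def)
qed

text \<open>The sign of the mean e errs with probability (1 - |e|) / 2, and |e| \<le> 1 gives e^2
  \<le> |e|. The bound is half the variance, the quantity that OSSS controls.\<close>

lemma leaf_error_le:
  assumes "g \<in> cube n \<rightarrow> {-1, 1}"
  shows "cube_expectation n (\<lambda>x. of_bool (pm_sign (cube_expectation n g) \<noteq> g x)) \<le>
    (1 - (cube_expectation n g)\<^sup>2) / 2"
proof -
  let ?e = "cube_expectation n g"
  have pm: "g x = -1 \<or> g x = 1" if "x \<in> cube n" for x
    using assms that by auto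
  have "cube_expectation n (\<lambda>x. of_bool (pm_sign ?e \<noteq> g x)) =
      cube_expectation n (\<lambda>x. (1 - pm_sign ?e * g x) / 2)"
  proof (rule cube_expectation_cong)
    fix x assume "x \<in> cube n"
    from pm[OF this] show "of_bool (pm_sign ?e \<noteq> g x) = (1 - pm_sign ?e * g x) / 2"
      by (auto simp: pm_sign_def)
  qed
  also have "\<dots> = (1 - \<bar>?e\<bar>) / 2"
    by (simp add: cube_expectation_diff diff_divide_distrib pm_sign_def)
  also have "\<dots> \<le> (1 - ?e\<^sup>2) / 2"
  proof -
    have "\<bar>?e\<bar> \<le> cube_expectation n (\<lambda>x. 1)"
      by (rule cube_expectation_abs_le) (use pm in fastforce)
    then have "\<bar>?e\<bar> * \<bar>?e\<bar> \<le> 1 * \<bar>?e\<bar>"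
      by (intro mult_right_mono) auto
    then have "?e\<^sup>2 \<le> \<bar>?e\<bar>"
      by (simp add: power2_eq_square)
    then show ?thesis
      by (intro divide_right_mono) auto
  qed
  finally show ?thesis .
qed

lemma queried_vars_label_leaves [simp]: "queried_vars (label_leaves g T) = queried_vars T"
  by (induction T arbitrary: g) auto

lemma dt_size_completion [simp]: "dt_size (completion n f T) = dt_size T"
proof -
  have "dt_size (label_leaves g T) = dt_size T" for g :: "path \<Rightarrow> real" and T :: "unit dtree"
    by (induction T arbitrary: g) auto
  then show ?thesis
    by (simp add: completion_def)
qed

text \<open>Condition on the root variable, which the subtrees ignore. The induction varies
  \<open>f\<close>, since each subtree is compared with the corresponding restriction of
  \<open>f\<close>.\<close>

lemma label_leaves_error_eq_leaf_avg:
  assumes "read_once T" "queried_vars T \<subseteq> {..<n}"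
  shows "measure_pmf.prob (unif n) {x. eval_dt (label_leaves g T) x \<noteq> f x} =
    leaf_avg (\<lambda>p. cube_expectation n (\<lambda>x. of_bool (g p \<noteq> restrict_path f p x))) T"
  unfolding prob_eq_cube_expectation using assms
proof (induction T arbitrary: g f)
  case (Query i l r)
  have i: "i < n" and il: "i \<notin> queried_vars l" and ir: "i \<notin> queried_vars r"
    using Query.prems by auto
  show ?case
    using Query.prems
    by (subst cube_expectation_split[OF i]) (simp add: il ir Query.IH)
qed simp

section \<open>The potential argument\<close>

lemma is_arg_max_exists:
  fixes h :: "'a \<Rightarrow> 'b :: linorder"
  assumes "finite A" "A \<noteq> {}"
  shows "\<exists>a. is_arg_max h (\<lambda>a. a \<in> A) a"
proof -
  obtain a where "a \<in> A" "h a = Max (h ` A)"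
    using Max_in[of "h ` A"] assms by fastforce
  then show ?thesis
    using assms(1) by (auto simp: is_arg_max_linorder)
qed

text \<open>The potential is multiplied by \<open>log 2 s\<close> to avoid dividing by it, as it is
  0 for \<open>s = 1\<close>. The logarithm of the size stands for the harmonic sum of the drops so
  far.\<close>

definition run_invariant ::
    "nat \<Rightarrow> ((nat \<Rightarrow> bool) \<Rightarrow> real) \<Rightarrow> nat \<Rightarrow> real \<Rightarrow> unit dtree \<Rightarrow> bool" where
  "run_invariant n f s \<epsilon> T \<longleftrightarrow> read_once T \<and> queried_vars T \<subseteq> {..<n} \<and>
     log 2 s * leaf_avg (\<lambda>p. total_influence n (restrict_path f p)) T + 2 * \<epsilon> * ln (dt_size T)
       \<le> log 2 s * sqrt (log 2 s)"

context
  fixes n s :: nat and \<epsilon> :: real and f :: "(nat \<Rightarrow> bool) \<Rightarrow> real"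
  assumes \<epsilon>: "0 < \<epsilon>" and s: "0 < s" and f: "computed_by_read_once n f s"
begin

lemma log_size_nonneg: "log 2 (real s) \<ge> 0"
  using s by simp

text \<open>The error is the average of the leaf errors, each at most half a variance, to which OSSS
  for the restriction applies. Any bound \<open>M\<close> on the influences is allowed, so that
  \<open>M = 0\<close> can later rule out \<open>n = 0\<close>.\<close>

lemma large_error_large_leaf_avg:
  assumes "read_once T" "queried_vars T \<subseteq> {..<n}"
    and "\<not> approximates n \<epsilon> f (completion n f T)"
    and M: "\<And>p i. p \<in> leaves T \<Longrightarrow> i < n \<Longrightarrow> influence n i (restrict_path f p) \<le> M p"
      "\<And>p. p \<in> leaves T \<Longrightarrow> 0 \<le> M p"
  shows "2 * \<epsilon> < leaf_avg M T * log 2 s"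
proof -
  let ?g = "restrict_path f"
  have "\<epsilon> < leaf_avg (\<lambda>p. cube_expectation n
      (\<lambda>x. of_bool (pm_sign (cube_expectation n (?g p)) \<noteq> ?g p x))) T"
    using assms(3)
    unfolding approximates_def completion_def label_leaves_error_eq_leaf_avg[OF assms(1,2)]
    by simp
  also have "\<dots> \<le> leaf_avg (\<lambda>p. M p * log 2 s / 2) T"
  proof (rule leaf_avg_mono)
    fix p assume p: "p \<in> leaves T"
    then have "computed_by_read_once n (?g p) s"
      using leaves_queried_vars[OF p] assms(2)
      by (intro computed_by_read_once_restrict_path[OF f]) auto
    from leaf_error_le[OF computed_by_read_once_pm[OF this]]
      variance_le_max_influence_log_size[OF this, of "M p"]
    show "cube_expectation n (\<lambda>x. of_bool (pm_sign (cube_expectation n (?g p)) \<noteq> ?g p x))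
        \<le> M p * log 2 s / 2"
      using M[OF p] by fastforce
  qed
  also have "\<dots> = leaf_avg M T * log 2 s / 2"
    by (simp add: leaf_avg_def sum_distrib_right sum_divide_distrib mult.assoc)
  finally show ?thesis
    by simp
qed

text \<open>The scaled potential falls by more than 2 \<epsilon> / m, where m is the size, while ln
  m grows by at most 1 / m. The claim on the size serves the termination proof.\<close>

lemma run_invariant_step:
  assumes "run_invariant n f s \<epsilon> T" "topdown_step n f \<epsilon> T T'"
  shows "run_invariant n f s \<epsilon> T' \<and> dt_size T' = Suc (dt_size T)"
  using assms(2)
proof cases
  case (1 v p)
  let ?g = "restrict_path f" and ?L = "log 2 (real s)"
  let ?\<Phi> = "leaf_avg (\<lambda>p. total_influence n (restrict_path f p))"
  let ?score = "\<lambda>p. (1/2) ^ length p * influence n (v p) (?g p)"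
  have T: "read_once T" "queried_vars T \<subseteq> {..<n}"
    and inv: "?L * ?\<Phi> T + 2 * \<epsilon> * ln (dt_size T) \<le> ?L * sqrt ?L"
    using assms(1) by (auto simp: run_invariant_def)
  have p: "p \<in> leaves T" and best: "\<And>q. q \<in> leaves T \<Longrightarrow> ?score q \<le> ?score p"
    using 1(4) by (auto simp: is_arg_max_linorder)
  have v: "v q < n" "\<And>i. i < n \<Longrightarrow> influence n i (?g q) \<le> influence n (v q) (?g q)"
    if "q \<in> leaves T" for q
    using 1(3) that by (auto simp: is_arg_max_linorder)
  define m where "m = real (dt_size T)"
  have m: "m > 0"
    by (simp add: m_def dt_size_pos)
  have "2 * \<epsilon> < leaf_avg (\<lambda>q. influence n (v q) (?g q)) T * ?L"
    by (rule large_error_large_leaf_avg[OF T 1(2)]) (auto simp: v influence_nonneg)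
  \<comment> \<open>The weighted sum has one score per leaf, \<open>m\<close> in all, none above the
    best.\<close>
  also have "leaf_avg (\<lambda>q. influence n (v q) (?g q)) T \<le> m * ?score p"
    unfolding leaf_avg_def m_def using sum_bounded_above[of "leaves T" ?score "?score p"] best
    by (simp add: card_leaves)
  finally have score: "2 * \<epsilon> < m * ?score p * ?L"
    using log_size_nonneg by (simp add: mult_right_mono)
  then have "influence n (v p) (?g p) \<noteq> 0"
    using \<epsilon> by auto
  then have "v p \<notin> fst ` set p"
    using influence_restrict_path_fixed by blast
  then have "read_once T'" "queried_vars T' \<subseteq> {..<n}" and size: "dt_size T' = Suc (dt_size T)"
    using read_once_split_leaf[OF p _ T(1)] queried_vars_split_leaf[of p "v p" T] T(2) v(1)[OF p]
      dt_size_split_leaf[OF p] by (auto simp: 1(1))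
  moreover have "?L * ?\<Phi> T' + 2 * \<epsilon> * ln (dt_size T') \<le> ?L * sqrt ?L"
  proof -
    have "?\<Phi> T' = ?\<Phi> T - ?score p"
      unfolding 1(1) leaf_avg_split_leaf[OF p] restrict_path_append
      by (simp add: total_influence_restrict_avg[OF v(1)[OF p]])
    then have "?L * ?\<Phi> T' = ?L * ?\<Phi> T - ?L * ?score p"
      by (simp only: right_diff_distrib)
    moreover have "2 * \<epsilon> * ln (1 + m) \<le> 2 * \<epsilon> * ln m + ?L * ?score p"
    proof -
      \<comment> \<open>This is ln x \<le> x - 1 at x = (1 + m) / m.\<close>
      have "ln (1 + m) - ln m \<le> 1 / m"
        using ln_le_minus_one[of "(1 + m) / m"] m by (simp add: ln_div field_simps)
      then have "2 * \<epsilon> * (ln (1 + m) - ln m) \<le> 2 * \<epsilon> * (1 / m)"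
        using \<epsilon> by (intro mult_left_mono) auto
      also have "\<dots> \<le> ?L * ?score p"
        using score m by (simp add: field_simps)
      finally show ?thesis
        by (simp add: algebra_simps)
    qed
    ultimately show ?thesis
      using inv unfolding size m_def of_nat_Suc by linarith
  qed
  ultimately show ?thesis
    by (simp add: run_invariant_def)
qed

lemma run_invariant_size_le:
  assumes "run_invariant n f s \<epsilon> T"
  shows "real (dt_size T) \<le> s powr (1 / (2 * ln 2) * sqrt (log 2 s) / \<epsilon>)"
proof -
  let ?L = "log 2 (real s)"
  have "leaf_avg (\<lambda>p. total_influence n (restrict_path f p)) T \<ge> 0"
    unfolding leaf_avg_def by (intro sum_nonneg mult_nonneg_nonneg total_influence_nonneg) auto
  then have "2 * \<epsilon> * ln (dt_size T) \<le> ?L * sqrt ?L"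
    using assms mult_nonneg_nonneg[OF log_size_nonneg] unfolding run_invariant_def by force
  then have "ln (dt_size T) \<le> ?L * sqrt ?L / (2 * \<epsilon>)"
    using \<epsilon> by (simp add: field_simps)
  \<comment> \<open>One factor \<open>log 2 s\<close> is rewritten as \<open>ln s / ln 2\<close>,
    which produces the constant of the theorem.\<close>
  also have "\<dots> = 1 / (2 * ln 2) * sqrt ?L / \<epsilon> * ln s"
    by (simp add: log_def field_simps)
  finally have "exp (ln (dt_size T)) \<le> exp (1 / (2 * ln 2) * sqrt ?L / \<epsilon> * ln s)"
    by simp
  then show ?thesis
    using s by (simp add: powr_def dt_size_pos)
qed

text \<open>Maximisers exist over finite nonempty sets; the only point at issue is that there is a
  variable at all.\<close>

lemma topdown_step_exists:
  assumes "run_invariant n f s \<epsilon> T" "\<not> approximates n \<epsilon> f (completion n f T)"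
  shows "\<exists>T'. topdown_step n f \<epsilon> T T'"
proof -
  let ?g = "restrict_path f"
  have T: "read_once T" "queried_vars T \<subseteq> {..<n}"
    using assms(1) by (auto simp: run_invariant_def)
  have "n \<noteq> 0"
  proof
    assume "n = 0"
    \<comment> \<open>With no variables the bound on influences holds vacuously for
      \<open>M = 0\<close>.\<close>
    then have "2 * \<epsilon> < leaf_avg (\<lambda>_. 0) T * log 2 s"
      by (intro large_error_large_leaf_avg[OF T assms(2)]) auto
    then show False
      using \<epsilon> by (simp add: leaf_avg_def)
  qed
  then have "\<exists>i. is_arg_max (\<lambda>i. influence n i (?g p)) (\<lambda>i. i < n) i" for p
    using is_arg_max_exists[of "{..<n}" "\<lambda>i. influence n i (?g p)"] by (simp add: lessThan_empty_iff)
  then obtain v where v: "\<And>p. is_arg_max (\<lambda>i. influence n i (?g p)) (\<lambda>i. i < n) (v p)"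
    by metis
  obtain p where "is_arg_max (\<lambda>p. (1/2) ^ length p * influence n (v p) (?g p)) (\<lambda>p. p \<in> leaves T) p"
    using is_arg_max_exists[OF finite_leaves leaves_nonempty] by blast
  then show ?thesis
    using topdown_step.intros[of n \<epsilon> f T v p] assms(2) v by blast
qed

text \<open>Every step enlarges the tree by one leaf, and the invariant caps its size by
  \<open>B\<close>, so \<open>B - dt_size T\<close> decreases.\<close>

lemma topdown_halts_if_run_invariant:
  assumes "run_invariant n f s \<epsilon> T"
  shows "topdown_halts n f \<epsilon> T"
proof -
  define B where "B = nat \<lfloor>s powr (1 / (2 * ln 2) * sqrt (log 2 s) / \<epsilon>)\<rfloor>"
  have size: "dt_size T \<le> B" if "run_invariant n f s \<epsilon> T" for T
    using run_invariant_size_le[OF that] unfolding B_def by linarith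
  show ?thesis
    using assms
  proof (induction "B - dt_size T" arbitrary: T rule: less_induct)
    case less
    show ?case
    proof (cases "approximates n \<epsilon> f (completion n f T)")
      case False
      have "topdown_halts n f \<epsilon> T'" if "topdown_step n f \<epsilon> T T'" for T'
        \<comment> \<open>The bound for \<open>T'\<close> puts the size of \<open>T\<close> strictly
          below \<open>B\<close>, so the truncated difference really drops.\<close>
        using run_invariant_step[OF less.prems that] size[of T'] by (intro less.hyps) auto
      with topdown_step_exists[OF less.prems False] show ?thesis
        by (blast intro: topdown_halts.iterate)
    qed (rule topdown_halts.exit)
  qed
qed

lemma run_invariant_reachable:
  assumes "(topdown_step n f \<epsilon>)\<^sup>*\<^sup>* T T'" "run_invariant n f s \<epsilon> T"
  shows "run_invariant n f s \<epsilon> T'"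
  using assms by (induction rule: rtranclp_induct) (auto dest: run_invariant_step)

text \<open>For a single leaf the logarithm vanishes and the potential is the total influence of
  \<open>f\<close>; here monotonicity enters.\<close>

lemma run_invariant_start:
  assumes "mono_on (cube n) f"
  shows "run_invariant n f s \<epsilon> (Leaf ())"
  using total_influence_mono_le[OF f assms] log_size_nonneg
  by (simp add: run_invariant_def mult_left_mono)

end

theorem theorem2p4:
  "\<exists>C::real. C > 0 \<and>
     (\<forall>(n::nat) (s::nat) (\<epsilon>::real) (f :: (nat \<Rightarrow> bool) \<Rightarrow> real).
        0 < \<epsilon> \<longrightarrow> \<epsilon> < 1/2 \<longrightarrow>
        f \<in> cube n \<rightarrow> {-1, 1} \<longrightarrow>
        mono_on (cube n) f \<longrightarrow>
        computable_by_dt_of_size n f s \<longrightarrow>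
          topdown_halts n f \<epsilon> (Leaf ()) \<and>
          (\<forall>T. topdown_output n f \<epsilon> T \<longrightarrow>
             real (dt_size T) \<le> real s powr (C * sqrt (log 2 (real s)) / \<epsilon>)))"
proof (intro exI[of _ "1 / (2 * ln 2)"] conjI allI impI)
  fix n s :: nat and \<epsilon> :: real and f :: "(nat \<Rightarrow> bool) \<Rightarrow> real"
  assume \<epsilon>: "0 < \<epsilon>" and mono: "mono_on (cube n) f" and comp: "computable_by_dt_of_size n f s"
  have f: "computed_by_read_once n f s" and s: "0 < s"
    using computed_by_read_once_if_computable[OF comp] comp dt_size_pos
    by (auto simp: computable_by_dt_of_size_def)
  note start = run_invariant_start[OF \<epsilon> s f mono]
  show "topdown_halts n f \<epsilon> (Leaf ())"
    by (rule topdown_halts_if_run_invariant[OF \<epsilon> s f start])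
  fix U assume "topdown_output n f \<epsilon> U"
  then obtain T where "(topdown_step n f \<epsilon>)\<^sup>*\<^sup>* (Leaf ()) T" and U: "U = completion n f T"
    by (auto simp: topdown_output_def)
  then have "run_invariant n f s \<epsilon> T"
    using run_invariant_reachable[OF \<epsilon> s f _ start] by blast
  then show "real (dt_size U) \<le> real s powr (1 / (2 * ln 2) * sqrt (log 2 (real s)) / \<epsilon>)"
    using run_invariant_size_le[OF \<epsilon> s f] by (simp add: U)
qed simp

end
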